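(* Let $n\ge 2$ be an integer, and let $F_k$ denote the $k$th Fibonacci number. Then $\#\mathcal{R}_\emptyset(n)=F_{n+1}$.
   Context: Fibonacci numbers: $F_1=F_2=1$ and $F_k=F_{k-1}+F_{k-2}$ for $k\geq 3$. A rim hook is a (nonempty, connected) skew shape, drawn in English notation (row $1$ at the top) and considered up to translation, that contains no $2\times 2$ square; its length is its number of squares. A rim hook of length $n$ can be read from its bottom-left end to its top-right end as a sequence of squares $s_1,\dots,s_n$, where each $s_{j+1}$ is immediately to the right of or immediately above $s_j$. A rim hook tableau is a filling of the squares with $1,\dots,n$, each used once, such that for any two vertically adjacent squares the upper one contains the smaller number, and for any two horizontally adjacent squares the left one contains the smaller number. Reading the entries along $s_1,\dots,s_n$ gives a permutation $w=[w_1,\dots,w_n]$ of $\{1,\dots,n\}$, with $w_j>w_{j+1}$ exactly when $s_{j+1}$ is above $s_j$; hence all tableaux of a given rim hook give permutations with the same descents. A double descent of a permutation $w$ of $\{1,\dots,n\}$ is an index $i$ with $2\le i\le n-1$ and $w_{i-1}>w_i>w_{i+1}$; the double descent set of $w$ is the set of its double descents. $\mathcal{R}_\emptyset(n)$ denotes the set of all rim hooks of length $n$ whose corresponding permutations have empty double descent set. *)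

theory Defs
  imports Main "HOL-Number_Theory.Fib"
begin

text \<open>A square is a pair (row, column), both counted from 0; row 0 is the top row
  (English notation).\<close>

type_synonym square = "nat \<times> nat"

definition is_partition :: "(nat \<Rightarrow> nat) \<Rightarrow> bool" where
  "is_partition l \<longleftrightarrow> antimono l \<and> finite {i. l i \<noteq> 0}"

definition skew_diagram :: "(nat \<Rightarrow> nat) \<Rightarrow> (nat \<Rightarrow> nat) \<Rightarrow> square set" where
  "skew_diagram l m = {(i, j). m i \<le> j \<and> j < l i}"

definition is_skew_shape :: "square set \<Rightarrow> bool" where
  "is_skew_shape S \<longleftrightarrow>
     (\<exists>l m. is_partition l \<and> is_partition m \<and> (\<forall>i. m i \<le> l i) \<and> S = skew_diagram l m)"

fun right_of :: "square \<Rightarrow> square \<Rightarrow> bool" where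
  "right_of (i, j) (i', j') \<longleftrightarrow> i = i' \<and> j = Suc j'"

fun above :: "square \<Rightarrow> square \<Rightarrow> bool" where
  "above (i, j) (i', j') \<longleftrightarrow> Suc i = i' \<and> j = j'"

definition adjacent :: "square \<Rightarrow> square \<Rightarrow> bool" where
  "adjacent s t \<longleftrightarrow> right_of s t \<or> right_of t s \<or> above s t \<or> above t s"

definition connected_shape :: "square set \<Rightarrow> bool" where
  "connected_shape S \<longleftrightarrow>
     (\<forall>s\<in>S. \<forall>t\<in>S. (s, t) \<in> {(u, v). u \<in> S \<and> v \<in> S \<and> adjacent u v}\<^sup>*)"

definition is_rim_hook :: "square set \<Rightarrow> bool" where
  "is_rim_hook S \<longleftrightarrow>
     is_skew_shape S \<and> S \<noteq> {} \<and> connected_shape S \<and>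
     \<not> (\<exists>i j. {(i, j), (i, Suc j), (Suc i, j), (Suc i, Suc j)} \<subseteq> S)"

text \<open>Rim hooks as placed shapes; passing to shapes up to translation is the quotient below.
  The translation vector may have negative coordinates.\<close>

definition rim_hook_shapes :: "nat \<Rightarrow> square set set" where
  "rim_hook_shapes n = {S. is_rim_hook S \<and> card S = n}"

definition is_translate :: "square set \<Rightarrow> square set \<Rightarrow> bool" where
  "is_translate S T \<longleftrightarrow>
     (\<exists>a b :: int. (\<lambda>(i, j). (int i, int j)) ` T = (\<lambda>(i, j). (int i + a, int j + b)) ` S)"

definition translation_rel :: "nat \<Rightarrow> (square set \<times> square set) set" where
  "translation_rel n =
     {(S, T). S \<in> rim_hook_shapes n \<and> T \<in> rim_hook_shapes n \<and> is_translate S T}"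

definition rim_hooks :: "nat \<Rightarrow> square set set set" where
  "rim_hooks n = rim_hook_shapes n // translation_rel n"

definition is_rim_hook_tableau :: "square set \<Rightarrow> (square \<Rightarrow> nat) \<Rightarrow> bool" where
  "is_rim_hook_tableau S f \<longleftrightarrow>
     bij_betw f S {1..card S} \<and>
     (\<forall>s\<in>S. \<forall>t\<in>S. above s t \<longrightarrow> f s < f t) \<and>
     (\<forall>s\<in>S. \<forall>t\<in>S. right_of t s \<longrightarrow> f s < f t)"

definition is_reading_order :: "square set \<Rightarrow> square list \<Rightarrow> bool" where
  "is_reading_order S ss \<longleftrightarrow>
     distinct ss \<and> set ss = S \<and> successively (\<lambda>s t. right_of t s \<or> above t s) ss"

text \<open>Permutations of {1..n} are lists in one-line notation.\<close>

definition rim_hook_perms :: "square set \<Rightarrow> nat list set" where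
  "rim_hook_perms S = {map f ss | f ss. is_rim_hook_tableau S f \<and> is_reading_order S ss}"

text \<open>Positions are counted from 1, so the entry at position i is \<open>w ! (i - 1)\<close>.\<close>

definition double_descent_set :: "nat list \<Rightarrow> nat set" where
  "double_descent_set w =
     {i. 2 \<le> i \<and> i + 1 \<le> length w \<and> w ! (i - 2) > w ! (i - 1) \<and> w ! (i - 1) > w ! i}"

text \<open>Every rim hook has a reading order and a tableau, so the condition on its
  permutations is not vacuous; it does not depend on the chosen tableau.\<close>

definition rim_hooks_with_double_descents :: "nat set \<Rightarrow> nat \<Rightarrow> square set set set" where
  "rim_hooks_with_double_descents D n =
     {H \<in> rim_hooks n. \<forall>S\<in>H. \<forall>w\<in>rim_hook_perms S. double_descent_set w = D}"

lemma equiv_translation_rel: "equiv (rim_hook_shapes n) (translation_rel n)"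
proof (rule equivI)
  show "translation_rel n \<subseteq> rim_hook_shapes n \<times> rim_hook_shapes n"
    by (auto simp: translation_rel_def)
  have "is_translate S S" for S
    unfolding is_translate_def by (intro exI[of _ 0]) auto
  then show "refl_on (rim_hook_shapes n) (translation_rel n)"
    by (auto simp: refl_on_def translation_rel_def)
  have "is_translate T S" if "is_translate S T" for S T
  proof -
    from that obtain a b :: int where
      *: "(\<lambda>(i, j). (int i, int j)) ` T = (\<lambda>(i, j). (int i + a, int j + b)) ` S"
      unfolding is_translate_def by (elim exE)
    have "(\<lambda>(i, j). (int i + - a, int j + - b)) ` T
        = (\<lambda>(x, y). (x - a, y - b)) ` (\<lambda>(i, j). (int i, int j)) ` T"
      by (simp add: image_image case_prod_beta)
    also have "\<dots> = (\<lambda>(i, j). (int i, int j)) ` S"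
      unfolding * by (simp add: image_image case_prod_beta)
    finally show ?thesis unfolding is_translate_def by (intro exI) (rule sym)
  qed
  then show "sym (translation_rel n)"
    by (auto simp: sym_def translation_rel_def)
  have "is_translate S U" if "is_translate S T" "is_translate T U" for S T U
  proof -
    from that obtain a b c d :: int where
      *: "(\<lambda>(i, j). (int i, int j)) ` T = (\<lambda>(i, j). (int i + a, int j + b)) ` S" and
      **: "(\<lambda>(i, j). (int i, int j)) ` U = (\<lambda>(i, j). (int i + c, int j + d)) ` T"
      unfolding is_translate_def by (elim exE)
    have "(\<lambda>(i, j). (int i, int j)) ` U
        = (\<lambda>(x, y). (x + c, y + d)) ` (\<lambda>(i, j). (int i, int j)) ` T"
      unfolding ** by (simp add: image_image case_prod_beta)
    also have "\<dots> = (\<lambda>(i, j). (int i + (a + c), int j + (b + d))) ` S"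
      unfolding * by (simp add: image_image case_prod_beta add.assoc)
    finally show ?thesis unfolding is_translate_def by (intro exI)
  qed
  then show "trans (translation_rel n)"
    unfolding translation_rel_def by (intro transI) auto
qed

end

theory Submission
  imports Defs
begin

text \<open>Read from top right to bottom left, a rim hook of length \<open>n\<close> is a word of \<open>n - 1\<close> steps,
  and two rim hooks are translates of each other iff their words agree. The reason is that the
  diagonal \<open>i - j\<close> of a square \<open>(i, j)\<close> changes by one along each step: a skew shape without
  \<open>2 \<times> 2\<close> square meets each diagonal at most once, and connectedness forces squares on
  neighbouring diagonals to be adjacent. A double descent of any tableau amounts to two
  consecutive vertical steps, and words without those are counted by Fibonacci numbers.\<close>

section \<open>Diagonals and lists of squares traced by a word\<close>

definition diagonal :: "square \<Rightarrow> int" where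
  "diagonal s = int (fst s) - int (snd s)"

text \<open>Squares are listed from top right to bottom left, against the reading order; \<open>True\<close>
  encodes a vertical step.\<close>

definition traces :: "bool list \<Rightarrow> square list \<Rightarrow> bool" where
  "traces w rs \<longleftrightarrow> length rs = Suc (length w) \<and>
     (\<forall>i<length w. if w ! i then above (rs ! i) (rs ! Suc i) else right_of (rs ! i) (rs ! Suc i))"

lemma above_iff: "above s t \<longleftrightarrow> Suc (fst s) = fst t \<and> snd s = snd t"
  by (cases s; cases t) auto

lemma right_of_iff: "right_of s t \<longleftrightarrow> fst s = fst t \<and> snd s = Suc (snd t)"
  by (cases s; cases t) auto

lemma adjacent_diagonal:
  assumes "adjacent u v"
  shows "\<bar>diagonal u - diagonal v\<bar> = 1"
  using assms by (auto simp: adjacent_def above_iff right_of_iff diagonal_def)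

lemma adjacent_next_diagonal:
  assumes "adjacent u v" "diagonal v = diagonal u + 1"
  shows "above u v \<or> right_of u v"
  using assms by (auto simp: adjacent_def above_iff right_of_iff diagonal_def)

lemma not_above_and_right_of: "\<not> (above s t \<and> right_of s t)"
  by (auto simp: above_iff right_of_iff)

lemma traces_stepD:
  assumes "traces w rs" "Suc i < length rs"
  shows "above (rs ! i) (rs ! Suc i) \<or> right_of (rs ! i) (rs ! Suc i)"
    and "w ! i \<longleftrightarrow> above (rs ! i) (rs ! Suc i)"
proof -
  have "if w ! i then above (rs ! i) (rs ! Suc i) else right_of (rs ! i) (rs ! Suc i)"
    using assms by (simp add: traces_def)
  then show "above (rs ! i) (rs ! Suc i) \<or> right_of (rs ! i) (rs ! Suc i)"
    and "w ! i \<longleftrightarrow> above (rs ! i) (rs ! Suc i)"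
    using not_above_and_right_of[of "rs ! i" "rs ! Suc i"] by (auto split: if_splits)
qed

lemma ex_tracesI:
  assumes "rs \<noteq> []"
    and "\<And>i. Suc i < length rs \<Longrightarrow> above (rs ! i) (rs ! Suc i) \<or> right_of (rs ! i) (rs ! Suc i)"
  shows "\<exists>w. traces w rs"
proof
  show "traces (map (\<lambda>i. above (rs ! i) (rs ! Suc i)) [0..<length rs - 1]) rs"
    using assms by (simp add: traces_def) (metis Suc_pred Suc_less_eq length_greater_0_conv)
qed

text \<open>A step goes down or to the left, and either raises row minus column by one. Hence
  position and diagonal agree up to a constant, which makes a trace duplicate-free and
  \<open>diagonal\<close> injective on it.\<close>

lemma traces_diagonal:
  assumes "traces w rs" "i < length rs"
  shows "diagonal (rs ! i) = diagonal (rs ! 0) + int i"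
  using assms(2)
proof (induction i)
  case (Suc i)
  then show ?case
    using traces_stepD(1)[OF assms(1) Suc.prems]
    by (auto simp: above_iff right_of_iff diagonal_def)
qed simp

lemma map_diagonal_traces:
  assumes "traces w rs"
  shows "map diagonal rs = map (\<lambda>i. diagonal (rs ! 0) + int i) [0..<length rs]"
  using traces_diagonal[OF assms] by (intro nth_equalityI) auto

lemma distinct_map_diagonal_traces:
  assumes "traces w rs"
  shows "distinct (map diagonal rs)"
  unfolding map_diagonal_traces[OF assms] by (simp add: distinct_map inj_on_def)

lemma traces_distinct: "traces w rs \<Longrightarrow> distinct rs"
  using distinct_map_diagonal_traces distinct_map by blast

lemma traces_inj_on_diagonal: "traces w rs \<Longrightarrow> inj_on diagonal (set rs)"
  using distinct_map_diagonal_traces distinct_map by blast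

subsection \<open>Words and shapes up to translation\<close>

text \<open>The values are integer points because a translation vector may be negative;
  \<open>shift 0 0\<close> is the embedding of squares.\<close>

definition shift :: "int \<Rightarrow> int \<Rightarrow> square \<Rightarrow> int \<times> int" where
  "shift a b s = (int (fst s) + a, int (snd s) + b)"

lemma is_translate_shift: "is_translate S T \<longleftrightarrow> (\<exists>a b. shift 0 0 ` T = shift a b ` S)"
  unfolding is_translate_def shift_def by (simp add: case_prod_beta)

lemma shift_0_eq_iff:
  "shift 0 0 t = shift a b s \<longleftrightarrow> int (fst t) = int (fst s) + a \<and> int (snd t) = int (snd s) + b"
  by (auto simp: shift_def)

text \<open>The word fixes every displacement from the first square, so the vector between the two
  first squares works for all later ones.\<close>

lemma traces_translate:
  assumes "traces w rs" "traces w rs'"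
  shows "is_translate (set rs) (set rs')"
proof -
  define a where "a = int (fst (rs' ! 0)) - int (fst (rs ! 0))"
  define b where "b = int (snd (rs' ! 0)) - int (snd (rs ! 0))"
  have len: "length rs' = length rs"
    using assms by (simp add: traces_def)
  have "shift 0 0 (rs' ! i) = shift a b (rs ! i)" if "i < length rs" for i
    using that
  proof (induction i)
    case 0
    then show ?case by (simp add: shift_def a_def b_def)
  next
    case (Suc i)
    then have "above (rs ! i) (rs ! Suc i) \<longleftrightarrow> above (rs' ! i) (rs' ! Suc i)"
      using traces_stepD(2)[OF assms(1)] traces_stepD(2)[OF assms(2)] len by simp
    then show ?case
      using Suc traces_stepD(1)[OF assms(1) Suc.prems] traces_stepD(1)[OF assms(2), of i] len
      by (auto simp: above_iff right_of_iff shift_0_eq_iff)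
  qed
  then have "map (shift 0 0) rs' = map (shift a b) rs"
    using len by (intro nth_equalityI) auto
  then have "shift 0 0 ` set rs' = shift a b ` set rs"
    by (metis list.set_map)
  then show ?thesis
    unfolding is_translate_shift by blast
qed

text \<open>A translation adds a constant to all diagonals, so it respects the order of a trace by
  diagonals. It therefore matches the two traces position by position, and vertical steps stay
  vertical.\<close>

lemma traces_unique:
  assumes "traces w rs" "traces w' rs'" "is_translate (set rs) (set rs')"
  shows "w = w'"
proof -
  obtain a b where ab: "shift 0 0 ` set rs' = shift a b ` set rs"
    using assms(3) is_translate_shift by blast
  \<comment> \<open>The counterpart of \<open>diagonal\<close> on integer points, where the
    translated squares live.\<close>
  define d where "d = (\<lambda>p :: int \<times> int. fst p - snd p)"
  have sd: "sorted (map d (map (shift a b) rs))" "distinct (map d (map (shift a b) rs))"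
    if "traces w rs" for a b w rs
  proof -
    have "map d (map (shift a b) rs) = map (\<lambda>x. x + (a - b)) (map diagonal rs)"
      by (simp add: d_def shift_def diagonal_def)
    also have "\<dots> = map (\<lambda>i. diagonal (rs ! 0) + (a - b) + int i) [0..<length rs]"
      unfolding map_diagonal_traces[OF that] by simp
    finally have *: "map d (map (shift a b) rs)
      = map (\<lambda>i. diagonal (rs ! 0) + (a - b) + int i) [0..<length rs]" .
    show "sorted (map d (map (shift a b) rs))"
      unfolding * by (simp add: sorted_iff_nth_mono)
    show "distinct (map d (map (shift a b) rs))"
      unfolding * by (simp add: distinct_map inj_on_def)
  qed
  \<comment> \<open>Both lists have the same set and are strictly increasing in \<open>d\<close>,
    which is injective there.\<close>
  have eq: "map (shift a b) rs = map (shift 0 0) rs'"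
  proof (rule map_sorted_distinct_set_unique)
    show "inj_on d (set (map (shift a b) rs) \<union> set (map (shift 0 0) rs'))"
      using sd(2)[OF assms(1), of a b] ab by (simp add: distinct_map inj_on_imageI)
  qed (use sd[OF assms(1)] sd[OF assms(2)] ab in auto)
  have len: "length rs = length rs'"
    using eq map_eq_imp_length_eq by blast
  have nth: "shift 0 0 (rs' ! i) = shift a b (rs ! i)" if "i < length rs" for i
    using arg_cong[OF eq, of "\<lambda>l. l ! i"] that len by simp
  show "w = w'"
  proof (rule nth_equalityI)
    show "length w = length w'"
      using assms len by (simp add: traces_def)
    fix i assume "i < length w"
    then have i: "Suc i < length rs"
      using assms by (simp add: traces_def)
    have "above (rs ! i) (rs ! Suc i) \<longleftrightarrow> above (rs' ! i) (rs' ! Suc i)"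
      using nth[of i] nth[of "Suc i"] i by (auto simp: above_iff shift_0_eq_iff)
    then show "w ! i \<longleftrightarrow> w' ! i"
      using traces_stepD(2)[OF assms(1) i] traces_stepD(2)[OF assms(2)] i len by simp
  qed
qed

section \<open>Reading orders as reversed traces\<close>

lemma reading_order_traces:
  assumes "is_reading_order S ss" "S \<noteq> {}"
  shows "\<exists>w. traces w (rev ss)"
proof (rule ex_tracesI)
  show "rev ss \<noteq> []"
    using assms by (auto simp: is_reading_order_def)
  have "successively (\<lambda>s t. right_of s t \<or> above s t) (rev ss)"
    using assms by (simp add: is_reading_order_def)
  then show "above (rev ss ! i) (rev ss ! Suc i) \<or> right_of (rev ss ! i) (rev ss ! Suc i)"
    if "Suc i < length (rev ss)" for i
    using that unfolding successively_conv_nth by blast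
qed

lemma traces_reading_order:
  assumes "traces w rs"
  shows "is_reading_order (set rs) (rev rs)"
  using traces_distinct[OF assms] traces_stepD(1)[OF assms]
  unfolding is_reading_order_def successively_rev by (auto simp: successively_conv_nth)

subsection \<open>Every rim hook is traced by a word\<close>

text \<open>Both row bounds decrease downwards, so \<open>m a \<le> m i \<le> j \<le> b\<close> and
  \<open>b \<le> j' < l i' \<le> l a\<close>.\<close>

lemma skew_shape_convex:
  assumes "is_skew_shape S" "(i, j) \<in> S" "(i', j') \<in> S" "i \<le> a" "a \<le> i'" "j \<le> b" "b \<le> j'"
  shows "(a, b) \<in> S"
proof -
  obtain l m where lm: "antimono l" "antimono m" "S = skew_diagram l m"
    using assms(1) by (auto simp: is_skew_shape_def is_partition_def)
  have "m a \<le> m i" "l i' \<le> l a"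
    using lm assms by (auto dest: antimonoD)
  then show ?thesis
    using assms lm by (auto simp: skew_diagram_def)
qed

text \<open>Two squares on one diagonal are opposite corners of a rectangle that lies in
  \<open>S\<close> by convexity and has a \<open>2 \<times> 2\<close> square at its upper left
  corner.\<close>

lemma rim_hook_inj_on_diagonal:
  assumes "is_rim_hook S"
  shows "inj_on diagonal S"
proof -
  have skew: "is_skew_shape S"
    using assms by (simp add: is_rim_hook_def)
  have False if "s \<in> S" "t \<in> S" "diagonal s = diagonal t" "fst s < fst t" for s t
  proof -
    obtain i j i' j' where [simp]: "s = (i, j)" "t = (i', j')"
      by (cases s; cases t) auto
    have ij: "i < i'" "j < j'"
      using that by (auto simp: diagonal_def)
    have st: "(i, j) \<in> S" "(i', j') \<in> S"
      using that by auto
    have "{(i, j), (i, Suc j), (Suc i, j), (Suc i, Suc j)} \<subseteq> S"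
      using ij skew_shape_convex[OF skew st] by auto
    then show False
      using assms by (auto simp: is_rim_hook_def)
  qed
  note * = this
  show ?thesis
  proof (rule inj_onI)
    fix s t assume st: "s \<in> S" "t \<in> S" "diagonal s = diagonal t"
    then have "fst s = fst t"
      using *[of s t] *[of t s] by (metis linorder_neqE_nat)
    with st show "s = t"
      by (auto simp: diagonal_def prod_eq_iff)
  qed
qed

text \<open>A discrete intermediate value theorem: the diagonal changes by one along each edge of a
  path, so it cannot jump over the passage from \<open>k\<close> to \<open>k + 1\<close>.\<close>

lemma rtrancl_crosses_diagonal:
  assumes "(s, t) \<in> {(u, v). u \<in> S \<and> v \<in> S \<and> adjacent u v}\<^sup>*"
    and "diagonal s \<le> k" "k < diagonal t"
  shows "\<exists>u\<in>S. \<exists>v\<in>S. adjacent u v \<and> diagonal u = k \<and> diagonal v = k + 1"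
  using assms(1,3)
proof (induction rule: rtrancl_induct)
  case base
  then show ?case using assms(2) by simp
next
  case (step y z)
  show ?case
  proof (cases "k < diagonal y")
    case False
    moreover have "\<bar>diagonal y - diagonal z\<bar> = 1"
      using step.hyps adjacent_diagonal by blast
    ultimately have "diagonal y = k" "diagonal z = k + 1"
      using step.prems by auto
    then show ?thesis using step.hyps by auto
  qed (use step.IH in blast)
qed

lemma rim_hook_traces:
  assumes "is_rim_hook S" "finite S"
  shows "\<exists>w rs. traces w rs \<and> set rs = S"
proof -
  have "S \<noteq> {}" and conn: "connected_shape S"
    using assms by (auto simp: is_rim_hook_def)
  have inj: "inj_on diagonal S"
    using assms rim_hook_inj_on_diagonal by blast
  define lo where "lo = Min (diagonal ` S)"
  define hi where "hi = Max (diagonal ` S)"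
  have lohi: "lo \<in> diagonal ` S" "hi \<in> diagonal ` S"
    unfolding lo_def hi_def using assms \<open>S \<noteq> {}\<close> by (auto intro!: Min_in Max_in)
  have bounds: "lo \<le> diagonal s" "diagonal s \<le> hi" if "s \<in> S" for s
    unfolding lo_def hi_def using that assms by auto
  have crossing: "\<exists>u\<in>S. \<exists>v\<in>S. adjacent u v \<and> diagonal u = k \<and> diagonal v = k + 1"
    if k: "lo \<le> k" "k < hi" for k
  proof -
    obtain s t where st: "s \<in> S" "t \<in> S" "diagonal s = lo" "diagonal t = hi"
      using lohi by auto
    then show ?thesis
      using conn k rtrancl_crosses_diagonal[of s t S k] by (auto simp: connected_shape_def)
  qed
  have diag: "diagonal ` S = {lo..hi}"
  proof
    show "{lo..hi} \<subseteq> diagonal ` S"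
    proof
      fix k assume "k \<in> {lo..hi}"
      then show "k \<in> diagonal ` S"
        using crossing[of k] lohi by (cases "k = hi") auto
    qed
  qed (use bounds in auto)
  \<comment> \<open>The unique square on a given diagonal; listing these squares by increasing
    diagonal yields the trace.\<close>
  define g where "g = inv_into S diagonal"
  define rs where "rs = map g [lo..hi]"
  have "lo \<le> hi"
    using lohi bounds by auto
  have "set rs = S"
    unfolding rs_def g_def using inj diag by (simp flip: diag)
  moreover have "\<exists>w. traces w rs"
  proof (rule ex_tracesI)
    show "rs \<noteq> []"
      using \<open>lo \<le> hi\<close> by (simp add: rs_def)
    fix i assume i: "Suc i < length rs"
    then have len: "int (Suc i) < hi - lo + 1"
      by (simp add: rs_def)
    \<comment> \<open>Connectedness gives some adjacent pair on these two diagonals; by injectivity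
      it is the pair at positions \<open>i\<close> and \<open>Suc i\<close>.\<close>
    obtain u v where uv: "u \<in> S" "v \<in> S" "adjacent u v"
      "diagonal u = lo + int i" "diagonal v = lo + int i + 1"
      using crossing[of "lo + int i"] len by auto
    have "rs ! i = g (lo + int i)" "rs ! Suc i = g (lo + int i + 1)"
      using len by (auto simp: rs_def algebra_simps)
    moreover have "g (lo + int i) = u" "g (lo + int i + 1) = v"
      unfolding g_def using uv inj by (metis inv_into_f_f)+
    ultimately show "above (rs ! i) (rs ! Suc i) \<or> right_of (rs ! i) (rs ! Suc i)"
      using uv adjacent_next_diagonal by auto
  qed
  ultimately show ?thesis by blast
qed

subsection \<open>Every word traces a rim hook\<close>

lemma traces_connected:
  assumes "traces w rs"
  shows "connected_shape (set rs)"
proof -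
  define R where "R = {(u, v). u \<in> set rs \<and> v \<in> set rs \<and> adjacent u v}"
  have "sym R"
    by (auto simp: sym_def R_def adjacent_def)
  then have sym: "sym (R\<^sup>*)"
    by (rule sym_rtrancl)
  \<comment> \<open>By symmetry it suffices to join every square to the first one.\<close>
  have from0: "(rs ! 0, rs ! i) \<in> R\<^sup>*" if "i < length rs" for i
    using that
  proof (induction i)
    case (Suc i)
    then have "(rs ! i, rs ! Suc i) \<in> R"
      using traces_stepD(1)[OF assms Suc.prems] by (auto simp: R_def adjacent_def)
    with Suc show ?case
      by (metis Suc_lessD rtrancl.rtrancl_into_rtrancl)
  qed simp
  have "(s, t) \<in> R\<^sup>*" if "s \<in> set rs" "t \<in> set rs" for s t
    using that from0 sym by (metis in_set_conv_nth rtrancl_trans symD)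
  then show ?thesis
    unfolding connected_shape_def R_def by blast
qed

text \<open>The squares \<open>(i, j)\<close> and \<open>(Suc i, Suc j)\<close> of a
  \<open>2 \<times> 2\<close> block share a diagonal, which a trace never allows. So only skewness
  remains to be checked for a concrete trace.\<close>

lemma traces_rim_hook:
  assumes "traces w rs" "is_skew_shape (set rs)"
  shows "is_rim_hook (set rs)"
proof -
  have "\<not> {(i, j), (i, Suc j), (Suc i, j), (Suc i, Suc j)} \<subseteq> set rs" for i j
  proof
    assume "{(i, j), (i, Suc j), (Suc i, j), (Suc i, Suc j)} \<subseteq> set rs"
    then have "(i, j) = (Suc i, Suc j)"
      using inj_onD[OF traces_inj_on_diagonal[OF assms(1)], of "(i, j)" "(Suc i, Suc j)"]
      by (simp add: diagonal_def)
    then show False by simp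
  qed
  moreover have "set rs \<noteq> {}"
    using assms(1) by (auto simp: traces_def)
  ultimately show ?thesis
    using assms traces_connected unfolding is_rim_hook_def by blast
qed

section \<open>Growing a shape at its top right end\<close>

lemma traces_Cons:
  assumes "traces w rs" "if u then above s (rs ! 0) else right_of s (rs ! 0)"
  shows "traces (u # w) (s # rs)"
  unfolding traces_def
proof (intro conjI allI impI)
  show "length (s # rs) = Suc (length (u # w))"
    using assms(1) by (simp add: traces_def)
  fix i assume "i < length (u # w)"
  then show "if (u # w) ! i then above ((s # rs) ! i) ((s # rs) ! Suc i)
      else right_of ((s # rs) ! i) ((s # rs) ! Suc i)"
    using assms by (cases i) (auto simp: traces_def)
qed

lemma traces_map_Suc:
  assumes "traces w rs"
  shows "traces w (map (map_prod Suc id) rs)"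
  using assms by (auto simp: traces_def above_iff right_of_iff)

text \<open>Serves the vertical step, where a new row is put on top of the diagram.\<close>

lemma is_partition_case_nat:
  assumes "is_partition l" "l 0 \<le> c"
  shows "is_partition (case_nat c l)"
proof -
  have anti: "antimono l" and fin: "finite {i. l i \<noteq> 0}"
    using assms by (auto simp: is_partition_def)
  have "{i. case_nat c l i \<noteq> 0} \<subseteq> insert 0 (Suc ` {i. l i \<noteq> 0})"
  proof
    fix i assume "i \<in> {i. case_nat c l i \<noteq> 0}"
    then show "i \<in> insert 0 (Suc ` {i. l i \<noteq> 0})"
      by (cases i) auto
  qed
  then have "finite {i. case_nat c l i \<noteq> 0}"
    using fin by (meson finite.insertI finite_imageI finite_subset)
  moreover have "case_nat c l (Suc i) \<le> case_nat c l i" for i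
    using assms(2) anti by (auto split: nat.splits simp: antimono_iff_le_Suc)
  ultimately show ?thesis
    by (simp add: is_partition_def antimono_iff_le_Suc)
qed

text \<open>Serves the horizontal step, where the top row is lengthened.\<close>

lemma is_partition_upd_0:
  assumes "is_partition l" "l 0 \<le> c"
  shows "is_partition (l(0 := c))"
proof -
  have anti: "antimono l" and fin: "finite {i. l i \<noteq> 0}"
    using assms by (auto simp: is_partition_def)
  have "{i. (l(0 := c)) i \<noteq> 0} \<subseteq> insert 0 {i. l i \<noteq> 0}"
    by auto
  then have "finite {i. (l(0 := c)) i \<noteq> 0}"
    using fin by (meson finite.insertI finite_subset)
  moreover have "(l(0 := c)) (Suc i) \<le> (l(0 := c)) i" for i
  proof (cases i)
    case 0
    have "l (Suc 0) \<le> l 0"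
      using anti by (simp add: antimono_iff_le_Suc)
    then show ?thesis using 0 assms(2) by simp
  qed (use anti in \<open>simp add: antimono_iff_le_Suc\<close>)
  ultimately show ?thesis
    by (simp add: is_partition_def antimono_iff_le_Suc)
qed

text \<open>The head of the word is the step at the top right end, so the induction attaches a
  square there. The last two conjuncts are the invariant that locates this end: the trace starts at
  the last square of the nonempty row 0.\<close>

lemma ex_traces_skew:
  "\<exists>rs l m. traces w rs \<and> is_partition l \<and> is_partition m \<and> (\<forall>i. m i \<le> l i)
     \<and> set rs = skew_diagram l m \<and> m 0 < l 0 \<and> rs ! 0 = (0, l 0 - 1)"
proof (induction w)
  case Nil
  define l :: "nat \<Rightarrow> nat" where "l = (\<lambda>i. 0)(0 := 1)"
  have "is_partition (\<lambda>i. 0)"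
    by (simp add: is_partition_def antimono_def)
  moreover from this have "is_partition l"
    unfolding l_def by (rule is_partition_upd_0) simp
  moreover have "set [(0, 0)] = skew_diagram l (\<lambda>i. 0)"
    by (auto simp: skew_diagram_def l_def split: if_splits)
  moreover have "traces [] [(0, 0)]"
    by (simp add: traces_def)
  moreover have "l 0 = 1"
    by (simp add: l_def)
  ultimately show ?case
    by - (rule exI[of _ "[(0, 0)]"], rule exI[of _ l], rule exI[of _ "\<lambda>i. 0"], simp)
next
  case (Cons u w)
  then obtain rs l m where IH: "traces w rs" "is_partition l" "is_partition m" "\<forall>i. m i \<le> l i"
    "set rs = skew_diagram l m" "m 0 < l 0" "rs ! 0 = (0, l 0 - 1)"
    by blast
  have "0 < length rs"
    using IH(1) by (simp add: traces_def)
  show ?case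
  proof (cases u)
    case True
    \<comment> \<open>The old shape moves down one row; the new row 0 is the single square over the
      old end, with column bounds \<open>l 0 - 1\<close> and \<open>l 0\<close>.\<close>
    let ?rs = "(0, l 0 - Suc 0) # map (map_prod Suc id) rs"
    have "traces (u # w) ?rs"
      using IH traces_map_Suc \<open>0 < length rs\<close> True by (intro traces_Cons) auto
    moreover have "is_partition (case_nat (l 0) l)" "is_partition (case_nat (l 0 - Suc 0) m)"
      using IH by (auto intro!: is_partition_case_nat)
    moreover have "\<forall>i. case_nat (l 0 - Suc 0) m i \<le> case_nat (l 0) l i"
      using IH by (auto split: nat.splits)
    moreover have "set ?rs = skew_diagram (case_nat (l 0) l) (case_nat (l 0 - Suc 0) m)"
      using IH(5,6) by (auto simp: skew_diagram_def image_iff split: nat.splits)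
    ultimately show ?thesis
      using IH(6) by - (rule exI[of _ ?rs], rule exI[of _ "case_nat (l 0) l"],
          rule exI[of _ "case_nat (l 0 - Suc 0) m"], simp)
  next
    case False
    \<comment> \<open>Row 0 grows by one square to the right, while \<open>m\<close> stays the
      same.\<close>
    let ?rs = "(0, l 0) # rs"
    have "traces (u # w) ?rs"
      using IH False by (intro traces_Cons) auto
    moreover have "is_partition (l(0 := Suc (l 0)))"
      using IH by (auto intro: is_partition_upd_0)
    moreover have "\<forall>i. m i \<le> (l(0 := Suc (l 0))) i"
      using IH(4) by (simp add: le_SucI)
    moreover have "set ?rs = skew_diagram (l(0 := Suc (l 0))) m"
      using IH(5,6) by (auto simp: skew_diagram_def split: if_splits)
    ultimately show ?thesis
      using IH by - (rule exI[of _ ?rs], rule exI[of _ "l(0 := Suc (l 0))"],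
          rule exI[of _ m], simp del: fun_upd_apply add: fun_upd_same)
  qed
qed

lemma ex_traces_rim_hook: "\<exists>rs. traces w rs \<and> is_rim_hook (set rs)"
proof -
  obtain rs l m where "traces w rs" "is_partition l" "is_partition m" "\<forall>i. m i \<le> l i"
    "set rs = skew_diagram l m"
    using ex_traces_skew[of w] by blast
  then show ?thesis
    using traces_rim_hook unfolding is_skew_shape_def by blast
qed

subsection \<open>Tableaux and double descents\<close>

lemma ex_bij_betw_strict_mono_key:
  fixes key :: "'a \<Rightarrow> 'b::linorder"
  assumes "finite S"
  shows "\<exists>f. bij_betw f S {1..card S} \<and> (\<forall>s\<in>S. \<forall>t\<in>S. key s < key t \<longrightarrow> f s < f t)"
  using assms
proof (induction rule: finite_ranking_induct[where f = key])
  case empty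
  show ?case by (rule exI[of _ "\<lambda>_. 0"]) (simp add: bij_betw_def)
next
  case (insert x S)
  show ?case
  proof (cases "x \<in> S")
    case True
    then show ?thesis using insert by (simp add: insert_absorb)
  next
    case False
    obtain f where f: "bij_betw f S {1..card S}"
      "\<forall>s\<in>S. \<forall>t\<in>S. key s < key t \<longrightarrow> f s < f t"
      using insert.IH by blast
    \<comment> \<open>The ranking induction adds an element whose key is at least all earlier keys,
      so it may take the next number.\<close>
    let ?g = "f(x := Suc (card S))"
    have "bij_betw ?g S {1..card S}"
      using f(1) False bij_betw_cong[of S ?g f] by fastforce
    then have "bij_betw ?g (S \<union> {x}) ({1..card S} \<union> {?g x})"
      using False by (intro notIn_Un_bij_betw) auto
    moreover have "{1..card S} \<union> {?g x} = {1..card (insert x S)}"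
      using False insert.hyps by auto
    moreover have "f s \<le> card S" if "s \<in> S" for s
      using f(1) that by (auto simp: bij_betw_def)
    then have "\<forall>s\<in>insert x S. \<forall>t\<in>insert x S. key s < key t \<longrightarrow> ?g s < ?g t"
      using f(2) insert.hyps False by (fastforce simp: less_Suc_eq_le dest: leD)
    ultimately show ?thesis
      by (intro exI[of _ ?g]) (simp del: fun_upd_apply)
  qed
qed

text \<open>Row plus column grows to the right and downwards, so any numbering by increasing
  antidiagonals is a tableau.\<close>

lemma ex_tableau:
  assumes "finite S"
  shows "\<exists>f. is_rim_hook_tableau S f"
proof -
  obtain f where "bij_betw f S {1..card S}"
    "\<forall>s\<in>S. \<forall>t\<in>S. fst s + snd s < fst t + snd t \<longrightarrow> f s < f t"
    using ex_bij_betw_strict_mono_key[OF assms, of "\<lambda>s. fst s + snd s"] by blast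
  then show ?thesis
    unfolding is_rim_hook_tableau_def by (auto simp: above_iff right_of_iff)
qed

lemma double_descent_set_rev_empty_iff:
  "double_descent_set (rev v) = {} \<longleftrightarrow>
     (\<forall>j. j + 2 < length v \<longrightarrow> \<not> (v ! j < v ! Suc j \<and> v ! Suc j < v ! Suc (Suc j)))"
  (is "_ \<longleftrightarrow> ?R")
proof -
  let ?n = "length v"
  \<comment> \<open>Position \<open>i\<close> of \<open>rev v\<close>, counted from 1, is index
    \<open>?n - i\<close> of \<open>v\<close>, and descents turn into ascents. The triple around it
    thus starts in \<open>v\<close> at index \<open>?n - Suc i\<close>.\<close>
  have *: "i \<in> double_descent_set (rev v) \<longleftrightarrow>
      v ! (?n - Suc i) < v ! Suc (?n - Suc i) \<and> v ! Suc (?n - Suc i) < v ! Suc (Suc (?n - Suc i))"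
    if "2 \<le> i" "i + 1 \<le> ?n" for i
  proof -
    have "?n - Suc (i - 1) = Suc (?n - Suc i)" "?n - Suc (i - 2) = Suc (Suc (?n - Suc i))"
      using that by auto
    then show ?thesis
      using that by (auto simp: double_descent_set_def rev_nth)
  qed
  show ?thesis
  proof
    assume empty: "double_descent_set (rev v) = {}"
    show ?R
    proof (intro allI impI)
      fix j assume "j + 2 < ?n"
      then show "\<not> (v ! j < v ! Suc j \<and> v ! Suc j < v ! Suc (Suc j))"
        using *[of "?n - Suc j"] empty by (simp add: Suc_diff_Suc)
    qed
  next
    assume R: ?R
    have False if i: "i \<in> double_descent_set (rev v)" for i
    proof -
      have bounds: "2 \<le> i" "i + 1 \<le> ?n"
        using i by (auto simp: double_descent_set_def)
      then have "?n - Suc i + 2 < ?n"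
        by arith
      then show False
        using *[OF bounds] i R by blast
    qed
    then show "double_descent_set (rev v) = {}" by blast
  qed
qed

abbreviation no_double_vertical :: "bool list \<Rightarrow> bool" where
  "no_double_vertical \<equiv> successively (\<lambda>x y. \<not> (x \<and> y))"

text \<open>Entries grow downwards and shrink to the left, so along the trace \<open>f\<close> rises
  exactly at the vertical steps, whatever the tableau.\<close>

lemma double_descent_set_tableau:
  assumes "traces w rs" "is_rim_hook_tableau (set rs) f"
  shows "double_descent_set (map f (rev rs)) = {} \<longleftrightarrow> no_double_vertical w"
proof -
  have len: "length rs = Suc (length w)"
    using assms(1) by (simp add: traces_def)
  have step: "f (rs ! i) < f (rs ! Suc i) \<longleftrightarrow> w ! i" if i: "Suc i < length rs" for i
  proof -
    have "rs ! i \<in> set rs" "rs ! Suc i \<in> set rs"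
      using i by auto
    then show ?thesis
      using traces_stepD[OF assms(1) i] assms(2) unfolding is_rim_hook_tableau_def
      by (meson not_less_iff_gr_or_eq)
  qed
  have "double_descent_set (map f (rev rs)) = {} \<longleftrightarrow>
     (\<forall>j. j + 2 < length rs \<longrightarrow> \<not> (w ! j \<and> w ! Suc j))"
    unfolding rev_map[symmetric] double_descent_set_rev_empty_iff using step by auto
  also have "\<dots> \<longleftrightarrow> no_double_vertical w"
    by (simp add: successively_conv_nth len)
  finally show ?thesis .
qed

subsection \<open>Counting\<close>

lemma card_no_double_vertical: "card {w. length w = k \<and> no_double_vertical w} = fib (k + 2)"
proof (induction k rule: fib.induct)
  case 1
  have "{w. length w = 0 \<and> no_double_vertical w} = {[]}"
    by auto
  then show ?case by simp
next
  case 2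
  have "{w. length w = Suc 0 \<and> no_double_vertical w} = {[True], [False]}"
    by (auto simp: length_Suc_conv)
  then show ?case by (simp add: numeral_eq_Suc)
next
  case (3 k)
  define A where "A k = {w. length w = k \<and> no_double_vertical w}" for k
  have fin: "finite (A k)" for k
    using finite_lists_length_eq[of "UNIV :: bool set" k]
    by (rule finite_subset[rotated]) (auto simp: A_def)
  \<comment> \<open>After \<open>False\<close> any admissible word may follow; \<open>True\<close>
    forces \<open>False\<close> next, and then the rest is free.\<close>
  have "A (Suc (Suc k)) = (#) False ` A (Suc k) \<union> (\<lambda>w. True # False # w) ` A k"
    by (auto simp: A_def length_Suc_conv successively_Cons image_iff)
  moreover have "(#) False ` A (Suc k) \<inter> (\<lambda>w. True # False # w) ` A k = {}"
    by auto
  ultimately have "card (A (Suc (Suc k))) = card (A (Suc k)) + card (A k)"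
    using fin by (simp add: card_Un_disjoint card_image inj_on_def)
  then show ?case
    using 3 unfolding A_def by simp
qed

theorem theorem4p4:
  fixes n :: nat
  assumes "n \<ge> 2"
  shows "card (rim_hooks_with_double_descents {} n) = fib (n + 1)"
proof -
  \<comment> \<open>One representative rim hook is chosen for each word; its translation class is
    \<open>cls w\<close>.\<close>
  obtain r where r: "\<And>w. traces w (r w)" "\<And>w. is_rim_hook (set (r w))"
    using ex_traces_rim_hook by metis
  define cls where "cls w = translation_rel n `` {set (r w)}" for w
  have equiv: "equiv (rim_hook_shapes n) (translation_rel n)"
    by (rule equiv_translation_rel)
  have shape: "set (r w) \<in> rim_hook_shapes n" if "length w = n - 1" for w
    using r[of w] that assms traces_distinct[OF r(1)[of w]]
    by (simp add: rim_hook_shapes_def distinct_card traces_def)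
  have inj: "inj_on cls {w. length w = n - 1}"
  proof (rule inj_onI)
    fix w w' assume w: "w \<in> {w. length w = n - 1}" "w' \<in> {w. length w = n - 1}" "cls w = cls w'"
    then have "(set (r w), set (r w')) \<in> translation_rel n"
      using eq_equiv_class[OF _ equiv] shape unfolding cls_def by blast
    then show "w = w'"
      using traces_unique[OF r(1) r(1)] by (auto simp: translation_rel_def)
  qed
  have hooks: "rim_hooks n = cls ` {w. length w = n - 1}"
  proof
    show "cls ` {w. length w = n - 1} \<subseteq> rim_hooks n"
      using shape unfolding rim_hooks_def cls_def by (auto intro: quotientI)
    show "rim_hooks n \<subseteq> cls ` {w. length w = n - 1}"
    proof
      fix H assume "H \<in> rim_hooks n"
      then obtain S where S: "S \<in> rim_hook_shapes n" "H = translation_rel n `` {S}"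
        unfolding rim_hooks_def by (auto elim: quotientE)
      \<comment> \<open>An infinite set has \<open>card\<close> 0, so \<open>card S = n\<close> with
        \<open>n\<close> positive forces finiteness.\<close>
      then have "is_rim_hook S" "card S = n" "finite S"
        using assms by (auto simp: rim_hook_shapes_def intro: card_ge_0_finite)
      then obtain w rs where w: "traces w rs" "set rs = S"
        using rim_hook_traces by blast
      then have len: "length w = n - 1"
        using \<open>card S = n\<close> traces_distinct[OF w(1)] distinct_card[of rs] by (simp add: traces_def)
      have "(set (r w), S) \<in> translation_rel n"
        using S shape[OF len] traces_translate[OF r(1) w(1)] w(2)
        by (simp add: translation_rel_def)
      then have "H = cls w"
        using equiv_class_eq[OF equiv] S(2) unfolding cls_def by metis
      with len show "H \<in> cls ` {w. length w = n - 1}" by blast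
    qed
  qed
  have descents: "(\<forall>S\<in>cls w. \<forall>p\<in>rim_hook_perms S. double_descent_set p = {})
      \<longleftrightarrow> no_double_vertical w" if len: "length w = n - 1" for w
  proof
    assume *: "\<forall>S\<in>cls w. \<forall>p\<in>rim_hook_perms S. double_descent_set p = {}"
    \<comment> \<open>Some tableau is needed here, since the assumption says nothing about a shape
      without permutations.\<close>
    obtain f where f: "is_rim_hook_tableau (set (r w)) f"
      using ex_tableau by blast
    have "set (r w) \<in> cls w"
      unfolding cls_def using equiv_class_self[OF equiv shape[OF len]] .
    moreover have "map f (rev (r w)) \<in> rim_hook_perms (set (r w))"
      using f traces_reading_order[OF r(1)] unfolding rim_hook_perms_def by blast
    ultimately show "no_double_vertical w"
      using * double_descent_set_tableau[OF r(1) f] by blast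
  next
    assume w: "no_double_vertical w"
    show "\<forall>S\<in>cls w. \<forall>p\<in>rim_hook_perms S. double_descent_set p = {}"
    proof (intro ballI)
      fix S p assume S: "S \<in> cls w" and "p \<in> rim_hook_perms S"
      then obtain f ss where p: "p = map f ss" "is_rim_hook_tableau S f" "is_reading_order S ss"
        unfolding rim_hook_perms_def by blast
      have tr: "is_translate (set (r w)) S" "is_rim_hook S"
        using S by (auto simp: cls_def translation_rel_def rim_hook_shapes_def)
      \<comment> \<open>The reading order of \<open>p\<close> is arbitrary, but reversed it traces a
        translate of \<open>set (r w)\<close>, so its word must be \<open>w\<close>.\<close>
      then obtain w' where w': "traces w' (rev ss)"
        using reading_order_traces[OF p(3)] by (auto simp: is_rim_hook_def)
      have set: "set (rev ss) = S"
        using p(3) by (simp add: is_reading_order_def)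
      have "w = w'"
        using traces_unique[OF r(1) w'] tr set by simp
      then show "double_descent_set p = {}"
        using double_descent_set_tableau[OF w', of f] p(1,2) set w by simp
    qed
  qed
  have "rim_hooks_with_double_descents {} n = cls ` {w. length w = n - 1 \<and> no_double_vertical w}"
    unfolding rim_hooks_with_double_descents_def hooks using descents by blast
  moreover have "inj_on cls {w. length w = n - 1 \<and> no_double_vertical w}"
    using inj by (rule inj_on_subset) blast
  ultimately have "card (rim_hooks_with_double_descents {} n) = fib (n - 1 + 2)"
    by (simp only: card_image card_no_double_vertical)
  moreover have "n - 1 + 2 = n + 1"
    using assms by simp
  ultimately show ?thesis by (simp only:)
qed

end
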